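(* Let $M(n)=\max\{\operatorname{th}_{\rm pzf}(G): G \text{ a connected graph of order } n\}$. Then $M(n)=\Omega(\sqrt n)$ and $M(n)=O(\sqrt n(\log n)^2)$.
   Context: Probabilistic zero forcing on a graph $G$: vertices are colored blue or white. The process proceeds in rounds $1,2,3,\dots$. In a round, let $B$ be the set of blue vertices at the start of the round; each blue vertex $u$ fires at each of its white neighbors $w$, and each such fire succeeds independently with probability $|N[u]\cap B|/\deg u$, where $N[u]$ is the closed neighborhood of $u$. At the end of the round, every white vertex at which at least one fire succeeded becomes blue. For a connected graph $G$ and nonempty $Z\subseteq V(G)$, $\mathrm{pt}_{\rm pzf}(G,Z)$ is the random variable equal to the number of the round in which the last white vertex turns blue when starting with exactly $Z$ blue, and $\operatorname{ept}(G,Z)=\mathbf{E}[\mathrm{pt}_{\rm pzf}(G,Z)]$. The probabilistic throttling number is $\operatorname{th}_{\rm pzf}(G)=\min_{Z}\big(|Z|+\operatorname{ept}(G,Z)\big)$, minimum over nonempty $Z\subseteq V(G)$. *)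

theory Defs
  imports
    "HOL-Probability.Probability"
    "HOL-Library.Landau_Symbols"
    "Graph_Theory.Graph_Theory"
begin

(* A simple graph is a pair_graph: finite vertex set, loopless symmetric set of arcs.  The edge uv
   is represented by the two arcs (u,v) and (v,u), so the out-degree is the degree. *)

definition closed_nbhd :: "'a pair_pre_digraph \<Rightarrow> 'a \<Rightarrow> 'a set" where
  "closed_nbhd G u = insert u {w. (u, w) \<in> parcs G}"

definition pzf_prob :: "'a pair_pre_digraph \<Rightarrow> 'a set \<Rightarrow> 'a \<Rightarrow> real" where
  "pzf_prob G B u = real (card (closed_nbhd G u \<inter> B)) / real (out_degree (with_proj G) u)"

(* The randomness of the process: for every round and every arc (u,w) an independent uniform
   variable on [0,1].  The fire of u at w in a round succeeds iff the variable of (u,w) in that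
   round is at most the firing probability of u, which is determined by the earlier rounds.
   The variables of arcs that do not lead from blue to white are not looked at. *)

definition pzf_round_space :: "'a pair_pre_digraph \<Rightarrow> ('a \<times> 'a \<Rightarrow> real) measure" where
  "pzf_round_space G = (\<Pi>\<^sub>M e\<in>parcs G. uniform_measure lborel {0..1})"

definition pzf_space :: "'a pair_pre_digraph \<Rightarrow> ('a \<times> 'a \<Rightarrow> real) stream measure" where
  "pzf_space G = stream_space (pzf_round_space G)"

definition pzf_round :: "'a pair_pre_digraph \<Rightarrow> ('a \<times> 'a \<Rightarrow> real) \<Rightarrow> 'a set \<Rightarrow> 'a set" where
  "pzf_round G x B =
     B \<union> {w \<in> pverts G - B. \<exists>u\<in>B. (u, w) \<in> parcs G \<and> x (u, w) \<le> pzf_prob G B u}"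

(* The blue vertices after t rounds; round t + 1 uses the t-th entry of the stream. *)
primrec pzf_blue ::
    "'a pair_pre_digraph \<Rightarrow> 'a set \<Rightarrow> ('a \<times> 'a \<Rightarrow> real) stream \<Rightarrow> nat \<Rightarrow> 'a set" where
  "pzf_blue G Z \<omega> 0 = Z"
| "pzf_blue G Z \<omega> (Suc t) = pzf_round G (\<omega> !! t) (pzf_blue G Z \<omega> t)"

(* The number of the round in which the last white vertex turns blue: 0 if Z is everything, and
   infinity if some vertex stays white forever. *)
definition pt_pzf ::
    "'a pair_pre_digraph \<Rightarrow> 'a set \<Rightarrow> ('a \<times> 'a \<Rightarrow> real) stream \<Rightarrow> enat" where
  "pt_pzf G Z \<omega> = Inf (enat ` {t. pzf_blue G Z \<omega> t = pverts G})"

definition ept_pzf :: "'a pair_pre_digraph \<Rightarrow> 'a set \<Rightarrow> ennreal" where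
  "ept_pzf G Z = (\<integral>\<^sup>+ \<omega>. ennreal_of_enat (pt_pzf G Z \<omega>) \<partial>pzf_space G)"

definition th_pzf :: "'a pair_pre_digraph \<Rightarrow> ennreal" where
  "th_pzf G = Min ((\<lambda>Z. of_nat (card Z) + ept_pzf G Z) ` {Z. Z \<noteq> {} \<and> Z \<subseteq> pverts G})"

(* The connected graphs of order n, up to isomorphism.  The constant for graphs is qualified
   because the topological notion has the same name. *)
definition connected_graphs :: "nat \<Rightarrow> nat pair_pre_digraph set" where
  "connected_graphs n =
     {G. pair_graph G \<and> Digraph_Component.connected (with_proj G) \<and> pverts G = {..<n}}"

(* For n = 0 there is no connected graph and the value is unspecified.  Where enn2real is applied to
   this value, infinity becomes 0; an Omega(sqrt n) bound for the result therefore entails that the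
   value is finite for all large n. *)
definition max_th_pzf :: "nat \<Rightarrow> ennreal" where
  "max_th_pzf n = Max (th_pzf ` connected_graphs n)"

(* The objects above are well behaved: a fire succeeds with the prescribed probability, the
   propagation time is a random variable, and max_th_pzf takes the maximum of a finite nonempty
   set. *)

lemma prob_space_pzf_round_space: "prob_space (pzf_round_space G)"
  unfolding pzf_round_space_def
  by (intro prob_space_PiM prob_space_uniform_measure) auto

lemma prob_space_pzf_space: "prob_space (pzf_space G)"
  unfolding pzf_space_def
  by (rule prob_space.prob_space_stream_space[OF prob_space_pzf_round_space])

lemma finite_connected_graphs: "finite (connected_graphs n)"
proof -
  have "connected_graphs n \<subseteq> (\<lambda>E. \<lparr>pverts = {..<n}, parcs = E\<rparr>) ` Pow ({..<n} \<times> {..<n})"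
  proof
    fix G assume "G \<in> connected_graphs n"
    then have G: "pair_graph G" "pverts G = {..<n}" by (auto simp: connected_graphs_def)
    interpret pair_graph G by fact
    have "parcs G \<subseteq> {..<n} \<times> {..<n}" unfolding G(2)[symmetric] by (auto dest: in_arcsD1 in_arcsD2)
    moreover have "G = \<lparr>pverts = {..<n}, parcs = parcs G\<rparr>" using G(2) by simp
    ultimately show "G \<in> (\<lambda>E. \<lparr>pverts = {..<n}, parcs = E\<rparr>) ` Pow ({..<n} \<times> {..<n})" by blast
  qed
  then show ?thesis by (rule finite_subset) simp
qed

lemma connected_graphs_nonempty: "n > 0 \<Longrightarrow> connected_graphs n \<noteq> {}"
proof -
  assume n: "n > 0"
  let ?G = "\<lparr>pverts = {..<n}, parcs = {(u,v). u < n \<and> v < n \<and> u \<noteq> v}\<rparr>"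
  have g: "pair_graph ?G"
    apply unfold_locales
    apply auto
    apply (rule finite_subset[of _ "{..<n} \<times> {..<n}"]; auto)
    apply (auto simp: symmetric_def sym_def)
    done
  have "Digraph_Component.connected (with_proj ?G)"
    unfolding connected_conv
  proof (intro conjI ballI)
    show "verts (with_proj ?G) \<noteq> {}" using n by auto
    fix u v assume a: "u \<in> verts (with_proj ?G)" "v \<in> verts (with_proj ?G)"
    have r: "(u, u) \<in> rtrancl_on (verts (with_proj ?G)) ((arcs_ends (with_proj ?G))\<^sup>s)"
      by (rule rtrancl_on_refl[OF a(1)])
    show "(u, v) \<in> rtrancl_on (verts (with_proj ?G)) ((arcs_ends (with_proj ?G))\<^sup>s)"
    proof (cases "u = v")
      case True then show ?thesis using r by simp
    next
      case False
      have "(u, v) \<in> (arcs_ends (with_proj ?G))\<^sup>s" using False a by (simp add: symcl_def)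
      then show ?thesis by (rule rtrancl_on_into_rtrancl_on[OF r _ a(2)])
    qed
  qed
  then have "?G \<in> connected_graphs n" using g unfolding connected_graphs_def by simp
  then show ?thesis by blast
qed

lemma measurable_pzf_blue:
  assumes "pair_graph G" "Z \<subseteq> pverts G"
  shows "(\<lambda>\<omega>. pzf_blue G Z \<omega> t) \<in> pzf_space G \<rightarrow>\<^sub>M count_space (Pow (pverts G))"
proof (induction t)
  case 0 show ?case using assms by auto
next
  case (Suc t)
  interpret pair_graph G by fact
  have fin: "finite (Pow (pverts G))" using pair_finite_verts by simp
  have 1: "Measurable.pred (pzf_space G) (\<lambda>\<omega>. (\<omega> !! t) e \<le> c)" if "e \<in> parcs G" for e c
  proof -
    have [measurable]: "(\<lambda>x. x e) \<in> borel_measurable (pzf_round_space G)"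
    proof -
      have "(\<lambda>x. x e) \<in> pzf_round_space G \<rightarrow>\<^sub>M uniform_measure lborel {0..1::real}"
        unfolding pzf_round_space_def using that by (rule measurable_component_singleton)
      moreover have "sets (uniform_measure lborel {0..1::real}) = sets borel" by simp
      ultimately show ?thesis using measurable_cong_sets[OF refl] by blast
    qed
    have "(\<lambda>\<omega>. (\<omega> !! t) e) \<in> borel_measurable (pzf_space G)"
      unfolding pzf_space_def by measurable
    then show ?thesis by measurable
  qed
  have 2: "(\<lambda>\<omega>. pzf_round G (\<omega> !! t) B) \<in> pzf_space G \<rightarrow>\<^sub>M count_space (Pow (pverts G))"
    if B: "B \<in> Pow (pverts G)" for B
  proof -
    have "Measurable.pred (pzf_space G) (\<lambda>\<omega>. \<exists>u\<in>B. (u, w) \<in> parcs G \<and> (\<omega> !! t) (u, w) \<le> pzf_prob G B u)" for w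
    proof -
      have fB: "finite B" using B pair_finite_verts by (auto intro: finite_subset)
      have "Measurable.pred (pzf_space G) (\<lambda>\<omega>. (u, w) \<in> parcs G \<and> (\<omega> !! t) (u, w) \<le> pzf_prob G B u)" for u
        by (cases "(u,w) \<in> parcs G") (auto intro: 1)
      then show ?thesis using fB by (intro pred_intros_finite) auto
    qed
    note P = this
    show ?thesis
    proof (subst measurable_count_space_eq2[OF fin], intro conjI ballI)
      show "(\<lambda>\<omega>. pzf_round G (\<omega> !! t) B) \<in> space (pzf_space G) \<rightarrow> Pow (pverts G)"
        using B by (auto simp: pzf_round_def)
      fix A assume A: "A \<in> Pow (pverts G)"
      have "(\<lambda>\<omega>. pzf_round G (\<omega> !! t) B) -` {A} \<inter> space (pzf_space G) =
        {\<omega>\<in>space (pzf_space G). \<forall>w\<in>pverts G. w \<in> A \<longleftrightarrow> w \<in> B \<or> (\<exists>u\<in>B. (u, w) \<in> parcs G \<and> (\<omega> !! t) (u, w) \<le> pzf_prob G B u)}"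
        using A B by (auto simp: pzf_round_def set_eq_iff)
      also have "\<dots> \<in> sets (pzf_space G)"
      proof -
        have "Measurable.pred (pzf_space G) (\<lambda>\<omega>. w \<in> A \<longleftrightarrow> w \<in> B \<or> (\<exists>u\<in>B. (u, w) \<in> parcs G \<and> (\<omega> !! t) (u, w) \<le> pzf_prob G B u))" for w
          using P[of w] by measurable
        then have "Measurable.pred (pzf_space G) (\<lambda>\<omega>. \<forall>w\<in>pverts G. w \<in> A \<longleftrightarrow> w \<in> B \<or> (\<exists>u\<in>B. (u, w) \<in> parcs G \<and> (\<omega> !! t) (u, w) \<le> pzf_prob G B u))"
          using pair_finite_verts by (intro pred_intros_finite) auto
        then show ?thesis by (simp add: pred_def)
      qed
      finally show "(\<lambda>\<omega>. pzf_round G (\<omega> !! t) B) -` {A} \<inter> space (pzf_space G) \<in> sets (pzf_space G)" .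
    qed
  qed
  show ?case
    unfolding pzf_blue.simps
    by (rule measurable_compose_countable'[where f = "\<lambda>B \<omega>. pzf_round G (\<omega> !! t) B" and g = "\<lambda>\<omega>. pzf_blue G Z \<omega> t", OF 2 Suc.IH countable_finite[OF fin]])
qed

lemma measurable_pt_pzf:
  assumes "pair_graph G" "Z \<subseteq> pverts G"
  shows "pt_pzf G Z \<in> pzf_space G \<rightarrow>\<^sub>M count_space UNIV"
proof -
  have [measurable]: "(\<lambda>\<omega>. pzf_blue G Z \<omega> t) \<in> pzf_space G \<rightarrow>\<^sub>M count_space (Pow (pverts G))" for t
    by (rule measurable_pzf_blue[OF assms])
  have "pt_pzf G Z = (\<lambda>\<omega>. INF t. if pzf_blue G Z \<omega> t = pverts G then enat t else \<infinity>)"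
  proof (rule ext, rule antisym)
    fix \<omega>
    show "pt_pzf G Z \<omega> \<le> (INF t. if pzf_blue G Z \<omega> t = pverts G then enat t else \<infinity>)"
      unfolding pt_pzf_def
    proof (rule INF_greatest)
      fix t show "Inf (enat ` {t. pzf_blue G Z \<omega> t = pverts G})
         \<le> (if pzf_blue G Z \<omega> t = pverts G then enat t else \<infinity>)"
        by (cases "pzf_blue G Z \<omega> t = pverts G") (simp_all add: INF_lower)
    qed
    show "(INF t. if pzf_blue G Z \<omega> t = pverts G then enat t else \<infinity>) \<le> pt_pzf G Z \<omega>"
      unfolding pt_pzf_def
    proof (rule INF_greatest)
      fix t assume "t \<in> {t. pzf_blue G Z \<omega> t = pverts G}"
      then show "(INF t. if pzf_blue G Z \<omega> t = pverts G then enat t else \<infinity>) \<le> enat t"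
        by (intro INF_lower2[of t]) simp_all
    qed
  qed
  moreover have "(\<lambda>\<omega>. if pzf_blue G Z \<omega> t = pverts G then enat t else \<infinity>) \<in> pzf_space G \<rightarrow>\<^sub>M count_space UNIV" for t
    by (rule measurable_compose[OF measurable_pzf_blue[OF assms], where g = "\<lambda>B. if B = pverts G then enat t else \<infinity>"]) simp
  ultimately show ?thesis by (simp only:) (rule measurable_INF; simp)
qed

lemma emeasure_fire_success:
  assumes "pair_graph G" "u \<in> B" "w \<notin> B" "(u, w) \<in> parcs G"
  shows "emeasure (pzf_round_space G) {x \<in> space (pzf_round_space G). x (u, w) \<le> pzf_prob G B u}
           = ennreal (pzf_prob G B u)"
proof -
  interpret pair_graph G by fact
  let ?U = "uniform_measure lborel {0..1::real}"
  let ?p = "pzf_prob G B u"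
  let ?N = "{v. (u, v) \<in> parcs G}"
  have fN: "finite ?N" 
    by (rule finite_subset[OF _ finite_imageI[OF pair_finite_arcs, of snd]]) force
  have deg: "out_degree (with_proj G) u = card ?N"
  proof -
    have "out_arcs (with_proj G) u = Pair u ` ?N" by (auto simp: out_arcs_def)
    then show ?thesis unfolding out_degree_def by (simp add: card_image inj_on_def)
  qed
  have "card (closed_nbhd G u \<inter> B) \<le> card (insert u (?N - {w}))"
    by (rule card_mono) (use fN assms in \<open>auto simp: closed_nbhd_def\<close>)
  also have "\<dots> \<le> Suc (card (?N - {w}))" by (simp add: card_insert_if fN)
  also have "\<dots> = card ?N" using fN assms by (intro card_Suc_Diff1) auto
  finally have p1: "?p \<le> 1" unfolding pzf_prob_def deg by (simp add: divide_le_eq)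
  have p0: "0 \<le> ?p" by (simp add: pzf_prob_def)
  have "emeasure (pzf_round_space G) {x \<in> space (pzf_round_space G). x (u, w) \<le> ?p}
     = emeasure (distr (pzf_round_space G) ?U (\<lambda>x. x (u,w))) {..?p}"
    unfolding pzf_round_space_def
    by (subst emeasure_distr) (use assms in \<open>auto intro!: arg_cong2[where f=emeasure]\<close>)
  also have "\<dots> = emeasure ?U {..?p}"
    unfolding pzf_round_space_def
    by (subst distr_PiM_component) (use assms in \<open>auto intro!: prob_space_uniform_measure\<close>)
  also have "\<dots> = emeasure lborel ({0..1} \<inter> {..?p})"
    by (simp add: emeasure_uniform_measure divide_ennreal_def)
  also have "{0..1} \<inter> {..?p} = {0..?p}" using p1 by auto
  finally show ?thesis using p0 by simp
qed

end

(* Lower bound: on a path a blue set grows by at most two vertices per round and initial vertex, so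
   pt >= (n/|Z| - 1)/2, and |Z| + n/(2|Z|) is at least of order sqrt n.

   Upper bound: fix a blue vertex u, and let w and k be the numbers of white and of blue vertices in
   N[u].  Counting only the fires of u, the ratio w/k contracts in expectation by the factor 7/10 in
   every round.  It is less than n at the start and at least 1/n while w > 0, so by Markov's
   inequality all of N[u] is blue after L rounds except with probability n^2 (7/10)^L.  With
   L of order log n, a union bound over vertices and blocks of L rounds shows that the blue set
   swallows one further distance layer per block, starting from any blue set.  A connected graph has
   a set Z of at most sqrt n + 1 vertices within distance about sqrt n of everything, so from any
   superset of Z all is blue with probability at least 1/2 after O(sqrt n log n) rounds;
   restarting at the end of each such period bounds the expected time by twice its length. *)
theory Submission
  imports Defs "HOL-Real_Asymp.Real_Asymp"
begin

section \<open>Moments of the number of successful fires\<close>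

abbreviation unit_uniform :: "real measure" where
  "unit_uniform \<equiv> uniform_measure lborel {0..1}"

text \<open>The event is a box, so its measure factors over the coordinates. Sets \<open>J\<close>
  of one and of two arcs give the first and second moments below.\<close>

lemma measure_PiM_unit_uniform_le:
  assumes I: "finite I" and J: "J \<subseteq> I" and p: "0 \<le> p" "p \<le> 1"
  shows "measure (\<Pi>\<^sub>M e\<in>I. unit_uniform) {x \<in> space (\<Pi>\<^sub>M e\<in>I. unit_uniform). \<forall>e\<in>J. x e \<le> p} = p ^ card J"
proof -
  interpret U: prob_space unit_uniform
    by (rule prob_space_uniform_measure) auto
  interpret finite_product_prob_space "\<lambda>_. unit_uniform" I
    by unfold_locales (rule I)
  have "{x \<in> space (\<Pi>\<^sub>M e\<in>I. unit_uniform). \<forall>e\<in>J. x e \<le> p}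
      = (\<Pi>\<^sub>E e\<in>I. if e \<in> J then {..p} else UNIV)"
    using J by (auto simp: space_PiM PiE_iff extensional_def split: if_splits)
  then have "measure (\<Pi>\<^sub>M e\<in>I. unit_uniform) {x \<in> space (\<Pi>\<^sub>M e\<in>I. unit_uniform). \<forall>e\<in>J. x e \<le> p}
      = (\<Prod>e\<in>I. measure unit_uniform (if e \<in> J then {..p} else UNIV))"
    by (simp only:) (rule prob_times, simp)
  also have "\<dots> = (\<Prod>e\<in>I. if e \<in> J then p else 1)"
  proof (rule prod.cong[OF refl])
    fix e
    have "{0..1} \<inter> {..p} = {0..p}" using p by auto
    then show "measure unit_uniform (if e \<in> J then {..p} else UNIV) = (if e \<in> J then p else 1)"
      using p U.prob_space by (simp add: measure_uniform_measure)
  qed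
  also have "\<dots> = p ^ card J"
    using J I by (simp add: prod.If_cases Int_absorb1)
  finally show ?thesis .
qed

lemma borel_measurable_PiM_unit_uniform_component:
  "e \<in> I \<Longrightarrow> (\<lambda>x. x e) \<in> borel_measurable (\<Pi>\<^sub>M e\<in>I. unit_uniform)"
proof -
  assume "e \<in> I"
  then have "(\<lambda>x. x e) \<in> (\<Pi>\<^sub>M e\<in>I. unit_uniform) \<rightarrow>\<^sub>M unit_uniform"
    by (rule measurable_component_singleton)
  moreover have "sets unit_uniform = sets borel" by simp
  ultimately show ?thesis using measurable_cong_sets[OF refl] by blast
qed

context
  fixes I W :: "'b set" and p :: real
  assumes I: "finite I" and W: "W \<subseteq> I" and p: "0 \<le> p" "p \<le> 1"
begin

lemma finite_trials: "finite W"
  using W I by (rule finite_subset)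

lemma card_successes_eq_sum: "real (card {e \<in> W. x e \<le> p}) = (\<Sum>e\<in>W. of_bool (x e \<le> p))"
  using finite_trials by (simp add: Int_def of_bool_def sum.If_cases)

lemma borel_measurable_card_successes:
  "(\<lambda>x. real (card {e \<in> W. x e \<le> p})) \<in> borel_measurable (\<Pi>\<^sub>M e\<in>I. unit_uniform)"
  unfolding card_successes_eq_sum
proof (rule borel_measurable_sum)
  fix e assume "e \<in> W"
  then have m: "(\<lambda>x. x e) \<in> borel_measurable (\<Pi>\<^sub>M e\<in>I. unit_uniform)"
    using W by (intro borel_measurable_PiM_unit_uniform_component) auto
  show "(\<lambda>x. of_bool (x e \<le> p) :: real) \<in> borel_measurable (\<Pi>\<^sub>M e\<in>I. unit_uniform)"
    by (rule measurable_compose[OF m]) measurable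
qed

lemma
  assumes J: "J \<subseteq> W"
  shows integrable_all_success:
      "integrable (\<Pi>\<^sub>M e\<in>I. unit_uniform) (\<lambda>x. of_bool (\<forall>e\<in>J. x e \<le> p) :: real)" (is ?A)
    and integral_all_success:
      "(\<integral>x. of_bool (\<forall>e\<in>J. x e \<le> p) \<partial>(\<Pi>\<^sub>M e\<in>I. unit_uniform)) = p ^ card J" (is ?B)
proof -
  let ?M = "\<Pi>\<^sub>M e\<in>I. unit_uniform"
  let ?S = "{x \<in> space ?M. \<forall>e\<in>J. x e \<le> p}"
  interpret prob_space ?M by (intro prob_space_PiM prob_space_uniform_measure) auto
  have JI: "J \<subseteq> I" using J W by auto
  have S: "?S \<in> sets ?M"
  proof -
    have "Measurable.pred ?M (\<lambda>x. x e \<le> p)" if "e \<in> J" for e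
    proof -
      have m: "(\<lambda>x. x e) \<in> borel_measurable ?M"
        using that JI by (intro borel_measurable_PiM_unit_uniform_component) auto
      show ?thesis by (rule measurable_compose[OF m]) measurable
    qed
    then have "Measurable.pred ?M (\<lambda>x. \<forall>e\<in>J. x e \<le> p)"
      using finite_subset[OF JI I] by (intro pred_intros_finite) auto
    then show ?thesis by (simp add: pred_def)
  qed
  have eq: "of_bool (\<forall>e\<in>J. x e \<le> p) = (indicator ?S x :: real)" if "x \<in> space ?M" for x
    using that by (auto simp: indicator_def)
  have int: "integrable ?M (indicator ?S :: _ \<Rightarrow> real)"
    using S by (simp add: integrable_indicator_iff emeasure_eq_measure)
  show ?A by (rule Bochner_Integration.integrable_cong[THEN iffD1, OF refl eq[symmetric] int])
  have "(\<integral>x. of_bool (\<forall>e\<in>J. x e \<le> p) \<partial>?M) = (\<integral>x. indicator ?S x \<partial>?M :: real)"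
    by (rule Bochner_Integration.integral_cong[OF refl eq])
  also have "\<dots> = measure ?M ?S" using S by simp
  also have "\<dots> = p ^ card J" by (rule measure_PiM_unit_uniform_le[OF I JI p])
  finally show ?B .
qed

lemma
  shows integrable_card_successes:
      "integrable (\<Pi>\<^sub>M e\<in>I. unit_uniform) (\<lambda>x. real (card {e \<in> W. x e \<le> p}))" (is ?A)
    and integral_card_successes:
      "(\<integral>x. real (card {e \<in> W. x e \<le> p}) \<partial>(\<Pi>\<^sub>M e\<in>I. unit_uniform)) = card W * p" (is ?B)
proof -
  have i: "integrable (\<Pi>\<^sub>M e\<in>I. unit_uniform) (\<lambda>x. of_bool (x e \<le> p) :: real)" if "e \<in> W" for e
    using integrable_all_success[of "{e}"] that by simp
  have v: "(\<integral>x. of_bool (x e \<le> p) \<partial>(\<Pi>\<^sub>M e\<in>I. unit_uniform)) = p" if "e \<in> W" for e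
    using integral_all_success[of "{e}"] that by simp
  show ?A unfolding card_successes_eq_sum by (rule Bochner_Integration.integrable_sum[OF i])
  show ?B unfolding card_successes_eq_sum
    by (subst Bochner_Integration.integral_sum[OF i]) (simp_all add: v)
qed

text \<open>The square is a double sum over pairs of trials. A pair of distinct trials succeeds with
  probability \<open>p * p\<close> and a diagonal pair with probability \<open>p\<close>; the bound
  grants the diagonal an extra \<open>p * p\<close>, which turns the sum into a perfect
  square.\<close>

lemma
  shows integrable_card_successes_sq:
      "integrable (\<Pi>\<^sub>M e\<in>I. unit_uniform) (\<lambda>x. (real (card {e \<in> W. x e \<le> p}))\<^sup>2)" (is ?A)
    and integral_card_successes_sq_le:
      "(\<integral>x. (real (card {e \<in> W. x e \<le> p}))\<^sup>2 \<partial>(\<Pi>\<^sub>M e\<in>I. unit_uniform)) \<le> card W * p + (card W * p)\<^sup>2" (is ?B)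
proof -
  let ?M = "\<Pi>\<^sub>M e\<in>I. unit_uniform"
  let ?h = "\<lambda>e e' x. of_bool (\<forall>a\<in>{e, e'}. x a \<le> p) :: real"
  have sq: "(real (card {e \<in> W. x e \<le> p}))\<^sup>2 = (\<Sum>e\<in>W. \<Sum>e'\<in>W. ?h e e' x)" for x
    unfolding card_successes_eq_sum power2_eq_square sum_product
    by (intro sum.cong) auto
  have i: "integrable ?M (?h e e')" if "e \<in> W" "e' \<in> W" for e e'
    by (rule integrable_all_success) (use that in auto)
  have v: "integral\<^sup>L ?M (?h e e') \<le> (if e' = e then p else 0) + p * p" if "e \<in> W" "e' \<in> W" for e e'
  proof -
    have "integral\<^sup>L ?M (?h e e') = p ^ card {e, e'}"
      by (rule integral_all_success) (use that in auto)
    then show ?thesis using p by (cases "e = e'") (auto simp: power2_eq_square)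
  qed
  show ?A unfolding sq by (intro Bochner_Integration.integrable_sum i)
  have "(\<integral>x. (real (card {e \<in> W. x e \<le> p}))\<^sup>2 \<partial>?M) = (\<Sum>e\<in>W. \<Sum>e'\<in>W. integral\<^sup>L ?M (?h e e'))"
    unfolding sq
    by (subst Bochner_Integration.integral_sum, intro Bochner_Integration.integrable_sum i, assumption+,
        intro sum.cong refl Bochner_Integration.integral_sum i, assumption+)
  also have "\<dots> \<le> (\<Sum>e\<in>W. \<Sum>e'\<in>W. (if e' = e then p else 0) + p * p)"
    by (intro sum_mono v)
  also have "\<dots> = card W * p + (card W * p)\<^sup>2"
    using finite_trials by (simp add: sum.distrib sum.delta power2_eq_square algebra_simps)
  finally show ?B .
qed

text \<open>Jensen's inequality points the wrong way for the convex function
  \<open>1 / (k + t)\<close>, hence the detour through a quadratic. With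
  \<open>m = card W / d\<close> the mean is \<open>m * k\<close>: the linear term contributes
  \<open>- m / 2\<close> and the quadratic term at most \<open>m / 5\<close>, because
  \<open>1 \<le> k\<close> and \<open>m \<le> 1\<close>. The sum is
  \<open>- 3/10 * m\<close>.\<close>

lemma nn_integral_inverse_card_successes_le:
  fixes d k :: real
  assumes k: "1 \<le> k" and p_eq: "p = k / d" and d: "0 < d" and w: "card W \<le> d"
  shows "(\<integral>\<^sup>+x. ennreal (1 / (k + card {e \<in> W. x e \<le> p})) \<partial>(\<Pi>\<^sub>M e\<in>I. unit_uniform))
    \<le> ennreal ((1 - 3/10 * (card W / d)) / k)"
proof -
  let ?M = "\<Pi>\<^sub>M e\<in>I. unit_uniform"
  let ?X = "\<lambda>x. real (card {e \<in> W. x e \<le> p})"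
  let ?q = "\<lambda>x. (1 - ?X x / (2 * k) + (?X x)\<^sup>2 / (10 * k\<^sup>2)) / k"
  interpret prob_space ?M by (intro prob_space_PiM prob_space_uniform_measure) auto
  \<comment> \<open>A quadratic majorant of \<open>1/(k + t)\<close> makes the first two moments of the number of successes suffice.\<close>
  have bound: "1 / (k + t) \<le> (1 - t / (2 * k) + t\<^sup>2 / (10 * k\<^sup>2)) / k" if t: "0 \<le> t" for t :: real
  proof -
    define y where "y = t / k"
    have y: "0 \<le> y" and ty: "t = k * y" using k t by (auto simp: y_def)
    \<comment> \<open>Cleared of denominators, the difference of the two sides is
      \<open>y * (5 - 4 * y + y^2) / 10\<close>, and the second factor is
      \<open>(y - 2)^2 + 1\<close>.\<close>
    have "0 \<le> y * ((y - 2)\<^sup>2 + 1)" using y by simp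
    then have "0 \<le> y * (5 - 4 * y + y\<^sup>2)" by (simp add: power2_eq_square algebra_simps)
    then have "1 \<le> (1 - y / 2 + y\<^sup>2 / 10) * (1 + y)"
      by (simp add: power2_eq_square field_simps)
    then have "1 / (1 + y) \<le> 1 - y / 2 + y\<^sup>2 / 10"
      using y by (simp add: divide_le_eq)
    then have "1 / (1 + y) / k \<le> (1 - y / 2 + y\<^sup>2 / 10) / k"
      using k by (intro divide_right_mono) auto
    moreover have "1 / (1 + y) / k = 1 / (k + t)" using ty by (simp add: algebra_simps)
    moreover have "1 - y / 2 + y\<^sup>2 / 10 = 1 - t / (2 * k) + t\<^sup>2 / (10 * k\<^sup>2)"
      using k by (simp add: ty power2_eq_square)
    ultimately show ?thesis by simp
  qed
  have int: "integrable ?M ?q"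
    by (intro Bochner_Integration.integrable_add Bochner_Integration.integrable_diff
        Bochner_Integration.integrable_divide integrable_card_successes integrable_card_successes_sq) auto
  have "(\<integral>\<^sup>+x. ennreal (1 / (k + ?X x)) \<partial>?M) \<le> (\<integral>\<^sup>+x. ennreal (?q x) \<partial>?M)"
    by (intro nn_integral_mono ennreal_leI bound) simp
  also have "\<dots> = ennreal (\<integral>x. ?q x \<partial>?M)"
  proof (rule nn_integral_eq_integral[OF int], rule AE_I2)
    fix x
    have "0 \<le> 1 / (k + ?X x)" using k by simp
    then show "0 \<le> ?q x" by (rule order_trans) (rule bound, simp)
  qed
  also have "\<dots> \<le> ennreal ((1 - 3/10 * (card W / d)) / k)"
  proof (rule ennreal_leI)
    define m where "m = card W / d"
    have m: "0 \<le> m" "m \<le> 1" using d w by (auto simp: m_def)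
    have wp: "card W * p = m * k" by (simp add: m_def p_eq)
    have "(\<integral>x. ?q x \<partial>?M) = (1 - (\<integral>x. ?X x \<partial>?M) / (2 * k) + (\<integral>x. (?X x)\<^sup>2 \<partial>?M) / (10 * k\<^sup>2)) / k"
      using integrable_card_successes integrable_card_successes_sq prob_space by simp
    also have "\<dots> \<le> (1 - m * k / (2 * k) + (m * k + (m * k)\<^sup>2) / (10 * k\<^sup>2)) / k"
      using integral_card_successes_sq_le k unfolding integral_card_successes wp
      by (intro divide_right_mono add_mono order_refl) auto
    also have "\<dots> = (1 - m / 2 + (m / k + m\<^sup>2) / 10) / k"
      using k by (simp add: field_simps power2_eq_square)
    also have "\<dots> \<le> (1 - m / 2 + (m + m) / 10) / k"
    proof -
      have "m / k \<le> m" using m k by (simp add: divide_le_eq mult_le_cancel_left1)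
      moreover have "m\<^sup>2 \<le> m" using m by (simp add: power2_eq_square mult_left_le)
      ultimately show ?thesis using k by (intro divide_right_mono add_mono order_refl) auto
    qed
    finally show "(\<integral>x. ?q x \<partial>?M) \<le> (1 - 3/10 * (card W / d)) / k"
      by (simp add: m_def)
  qed
  finally show ?thesis .
qed

end

section \<open>The transition operator\<close>

context pair_graph
begin

definition nbhd :: "'a \<Rightarrow> 'a set" where
  "nbhd u = {w. (u, w) \<in> parcs G}"

lemma nbhd_subset: "nbhd u \<subseteq> pverts G"
  by (auto simp: nbhd_def dest: in_arcsD2)

lemma finite_nbhd [simp]: "finite (nbhd u)"
  using nbhd_subset pair_finite_verts by (rule finite_subset)

lemma nbhd_irrefl [simp]: "u \<notin> nbhd u"
  using pair_no_loops[of "(u, u)"] by (auto simp: nbhd_def)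

lemma nbhd_sym: "v \<in> nbhd u \<Longrightarrow> u \<in> nbhd v"
  using pair_sym_arcs by (auto simp: nbhd_def symmetric_def sym_def)

lemma closed_nbhd_eq: "closed_nbhd G u = insert u (nbhd u)"
  by (simp add: closed_nbhd_def nbhd_def)

lemma out_degree_eq_card_nbhd: "out_degree (with_proj G) u = card (nbhd u)"
proof -
  have "out_arcs (with_proj G) u = Pair u ` nbhd u" by (auto simp: out_arcs_def nbhd_def)
  then show ?thesis unfolding out_degree_def by (simp add: card_image inj_on_def)
qed

lemma pzf_round_superset: "B \<subseteq> pzf_round G x B"
  by (auto simp: pzf_round_def)

lemma pzf_round_subset: "B \<subseteq> pverts G \<Longrightarrow> pzf_round G x B \<subseteq> pverts G"
  by (auto simp: pzf_round_def)

lemma pzf_blue_subset: "B \<subseteq> pverts G \<Longrightarrow> pzf_blue G B \<omega> t \<subseteq> pverts G"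
  by (induction t) (simp_all add: pzf_round_subset)

lemma pzf_blue_Stream: "pzf_blue G B (x ## \<omega>) (Suc t) = pzf_blue G (pzf_round G x B) \<omega> t"
  by (induction t) simp_all

lemma measurable_pzf_round:
  assumes B: "B \<subseteq> pverts G"
  shows "(\<lambda>x. pzf_round G x B) \<in> pzf_round_space G \<rightarrow>\<^sub>M count_space (Pow (pverts G))"
proof -
  \<comment> \<open>On the constant stream with entry \<open>x\<close>, the blue set after one round
    is \<open>pzf_round G x B\<close>, so the measurability of \<open>pzf_blue\<close> carries
    over.\<close>
  have "sconst \<in> pzf_round_space G \<rightarrow>\<^sub>M pzf_space G"
    unfolding pzf_space_def by (rule measurable_stream_space2) simp
  from measurable_compose[OF this measurable_pzf_blue[OF pair_graph_axioms B, of 1]]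
  show ?thesis by simp
qed

lemma borel_measurable_pzf_round:
  assumes "B \<subseteq> pverts G"
  shows "(\<lambda>x. f (pzf_round G x B) :: ennreal) \<in> borel_measurable (pzf_round_space G)"
  by (rule measurable_compose[OF measurable_pzf_round[OF assms]]) simp

lemma borel_measurable_pzf_blue:
  assumes "B \<subseteq> pverts G"
  shows "(\<lambda>\<omega>. f (pzf_blue G B \<omega> t) :: ennreal) \<in> borel_measurable (pzf_space G)"
  by (rule measurable_compose[OF measurable_pzf_blue[OF pair_graph_axioms assms]]) simp

text \<open>The expectation of \<open>f\<close> after one round started from \<open>B\<close>; its powers give the process after several rounds,
  so that the Markov property is the additivity of exponents.\<close>
definition pzf_step :: "('a set \<Rightarrow> ennreal) \<Rightarrow> 'a set \<Rightarrow> ennreal" where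
  "pzf_step f B = (\<integral>\<^sup>+x. f (pzf_round G x B) \<partial>pzf_round_space G)"

text \<open>Fubini splits off the first entry of the stream; the rest is again such a process,
  started from a random set, so the induction runs over all \<open>B\<close>. The rules below for
  sums, factors and constants go back to a single integral through this identity.\<close>

lemma nn_integral_pzf_blue:
  assumes "B \<subseteq> pverts G"
  shows "(\<integral>\<^sup>+\<omega>. f (pzf_blue G B \<omega> t) \<partial>pzf_space G) = (pzf_step ^^ t) f B"
  using assms
proof (induction t arbitrary: B)
  case 0
  interpret prob_space "pzf_space G" by (rule prob_space_pzf_space)
  show ?case by (simp add: emeasure_space_1)
next
  case (Suc t)
  interpret prob_space "pzf_round_space G" by (rule prob_space_pzf_round_space)
  have "(\<integral>\<^sup>+\<omega>. f (pzf_blue G B \<omega> (Suc t)) \<partial>pzf_space G)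
      = (\<integral>\<^sup>+x. (\<integral>\<^sup>+\<omega>. f (pzf_blue G B (x ## \<omega>) (Suc t)) \<partial>pzf_space G) \<partial>pzf_round_space G)"
    using borel_measurable_pzf_blue[OF Suc.prems, of f "Suc t"] unfolding pzf_space_def
    by (rule nn_integral_stream_space)
  also have "\<dots> = (\<integral>\<^sup>+x. (pzf_step ^^ t) f (pzf_round G x B) \<partial>pzf_round_space G)"
    unfolding pzf_blue_Stream by (simp add: Suc.IH pzf_round_subset Suc.prems)
  finally show ?case by (simp add: pzf_step_def[of "(pzf_step ^^ t) f"])
qed

text \<open>Blue vertices stay blue, so the process visits only supersets of \<open>B\<close>.
  Restricting the comparison to these lets later estimates rely on a given vertex or set being blue
  still.\<close>

lemma pzf_step_funpow_mono:
  assumes "\<And>C. B \<subseteq> C \<Longrightarrow> C \<subseteq> pverts G \<Longrightarrow> f C \<le> g C" and "B \<subseteq> pverts G"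
  shows "(pzf_step ^^ t) f B \<le> (pzf_step ^^ t) g B"
  using assms
proof (induction t arbitrary: B)
  case (Suc t)
  have "(pzf_step ^^ t) f (pzf_round G x B) \<le> (pzf_step ^^ t) g (pzf_round G x B)" for x
    by (rule Suc.IH) (use Suc.prems pzf_round_superset[of B x] pzf_round_subset[of B x] in auto)
  then show ?case
    by (simp add: pzf_step_def[of "(pzf_step ^^ t) _"] nn_integral_mono)
qed simp

lemma pzf_step_funpow_sum:
  assumes "B \<subseteq> pverts G"
  shows "(pzf_step ^^ t) (\<lambda>C. \<Sum>i\<in>I. f i C) B = (\<Sum>i\<in>I. (pzf_step ^^ t) (f i) B)"
  unfolding nn_integral_pzf_blue[OF assms, symmetric]
  by (rule nn_integral_sum) (rule borel_measurable_pzf_blue[OF assms])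

lemma pzf_step_funpow_cmult:
  assumes "B \<subseteq> pverts G"
  shows "(pzf_step ^^ t) (\<lambda>C. c * f C) B = c * (pzf_step ^^ t) f B"
  unfolding nn_integral_pzf_blue[OF assms, symmetric]
  by (rule nn_integral_cmult) (rule borel_measurable_pzf_blue[OF assms])

lemma pzf_step_funpow_add_const:
  assumes "B \<subseteq> pverts G"
  shows "(pzf_step ^^ t) (\<lambda>C. f C + c) B = (pzf_step ^^ t) f B + c"
proof -
  interpret prob_space "pzf_space G" by (rule prob_space_pzf_space)
  show ?thesis
    unfolding nn_integral_pzf_blue[OF assms, symmetric]
    by (subst nn_integral_add) (simp_all add: borel_measurable_pzf_blue[OF assms] emeasure_space_1)
qed

lemma pzf_step_funpow_le_const:
  assumes "\<And>C. B \<subseteq> C \<Longrightarrow> C \<subseteq> pverts G \<Longrightarrow> f C \<le> c" and B: "B \<subseteq> pverts G"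
  shows "(pzf_step ^^ t) f B \<le> c"
proof -
  \<comment> \<open>The constants are written as \<open>0 + c\<close> and \<open>0 * 0\<close> so
    that the two preceding rules evaluate them.\<close>
  have "(pzf_step ^^ t) f B \<le> (pzf_step ^^ t) (\<lambda>_. 0 + c) B"
    by (rule pzf_step_funpow_mono) (use assms in auto)
  also have "\<dots> = (pzf_step ^^ t) (\<lambda>C. 0 * 0) B + c"
    by (subst pzf_step_funpow_add_const[OF B]) simp
  also have "\<dots> = c" by (subst pzf_step_funpow_cmult[OF B]) simp
  finally show ?thesis .
qed

lemma pzf_step_funpow_add: "(pzf_step ^^ (s + t)) f B = (pzf_step ^^ s) ((pzf_step ^^ t) f) B"
  by (simp add: funpow_add)

section \<open>Contraction of the white-to-blue ratio around a blue vertex\<close>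

definition white_ratio :: "'a \<Rightarrow> 'a set \<Rightarrow> real" where
  "white_ratio u B = card (nbhd u - B) / card (closed_nbhd G u \<inter> B)"

lemma card_white_plus_card_blue:
  assumes "u \<in> B"
  shows "card (nbhd u - B) + card (closed_nbhd G u \<inter> B) = card (nbhd u) + 1"
proof -
  have "card (nbhd u - B) + card (closed_nbhd G u \<inter> B) = card ((nbhd u - B) \<union> (closed_nbhd G u \<inter> B))"
    by (rule card_Un_disjoint[symmetric]) (auto simp: closed_nbhd_eq)
  also have "(nbhd u - B) \<union> (closed_nbhd G u \<inter> B) = insert u (nbhd u)"
    using assms by (auto simp: closed_nbhd_eq)
  finally show ?thesis by simp
qed

lemma card_blue_pos: "u \<in> B \<Longrightarrow> 0 < card (closed_nbhd G u \<inter> B)"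
  by (auto simp: closed_nbhd_eq card_gt_0_iff)

text \<open>White and blue vertices of the closed neighborhood add up to the degree plus 1. Shifted
  by 1, the ratio is thus a constant over the blue count, which reduces its expectation to that of a
  reciprocal.\<close>

lemma white_ratio_eq:
  assumes "u \<in> B"
  shows "white_ratio u B + 1 = (card (nbhd u) + 1) / card (closed_nbhd G u \<inter> B)"
proof -
  have "real (card (nbhd u) + 1) = card (nbhd u - B) + card (closed_nbhd G u \<inter> B)"
    using card_white_plus_card_blue[OF assms] by linarith
  then show ?thesis
    using card_blue_pos[OF assms] by (simp add: white_ratio_def add_divide_distrib)
qed

text \<open>The fires of \<open>u\<close> alone are \<open>w\<close> independent trials with success
  probability \<open>k / d\<close>; fires of other vertices can only lower the ratio further. The
  bound on the expected reciprocal gives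
  \<open>(d + 1) / k - 3/10 * (w / k) * ((d + 1) / d)\<close>, and
  \<open>(d + 1) / k = w / k + 1\<close>.\<close>

lemma pzf_step_white_ratio:
  assumes u: "u \<in> B" and B: "B \<subseteq> pverts G"
  shows "pzf_step (\<lambda>C. ennreal (white_ratio u C)) B \<le> ennreal (7/10) * ennreal (white_ratio u B)"
proof (cases "nbhd u \<subseteq> B")
  case True
  then have "nbhd u - pzf_round G x B = {}" for x using pzf_round_superset[of B x] by auto
  then have "white_ratio u (pzf_round G x B) = 0" for x by (simp only: white_ratio_def card.empty)
  then show ?thesis by (simp add: pzf_step_def)
next
  case False
  let ?M = "pzf_round_space G"
  define d k w where "d = card (nbhd u)" and "k = card (closed_nbhd G u \<inter> B)"
    and "w = card (nbhd u - B)"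
  define W where "W = Pair u ` (nbhd u - B)"
  define p where "p = pzf_prob G B u"
  have wk: "w + k = d + 1" using card_white_plus_card_blue[OF u] by (simp add: d_def k_def w_def)
  have k: "0 < k" using card_blue_pos[OF u] by (simp add: k_def)
  have w: "0 < w" using False by (auto simp: w_def card_gt_0_iff)
  have d: "0 < d" using wk k w by linarith
  have p_eq: "p = real k / real d" by (simp add: p_def pzf_prob_def k_def d_def out_degree_eq_card_nbhd)
  have p: "0 \<le> p" "p \<le> 1" using d w wk by (auto simp: p_eq divide_le_eq)
  have W: "W \<subseteq> parcs G" by (auto simp: W_def nbhd_def)
  have cW: "card W = w" by (simp add: W_def w_def card_image inj_on_def)
  interpret prob_space ?M by (rule prob_space_pzf_round_space)
  have grow: "white_ratio u (pzf_round G x B) + 1 \<le> (d + 1) * (1 / (real k + card {e \<in> W. x e \<le> p}))" for x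
  proof -
    let ?C = "pzf_round G x B"
    let ?S = "snd ` {e \<in> W. x e \<le> p}"
    have uC: "u \<in> ?C" using u pzf_round_superset[of B x] by auto
    have "?S \<subseteq> ?C"
      using u nbhd_subset by (force simp: W_def p_def pzf_round_def nbhd_def)
    then have "closed_nbhd G u \<inter> B \<union> ?S \<subseteq> closed_nbhd G u \<inter> ?C"
      using pzf_round_superset[of B x] by (auto simp: W_def closed_nbhd_eq)
    then have "card (closed_nbhd G u \<inter> B \<union> ?S) \<le> card (closed_nbhd G u \<inter> ?C)"
      by (rule card_mono[rotated]) (simp add: closed_nbhd_eq)
    moreover have "card (closed_nbhd G u \<inter> B \<union> ?S) = k + card ?S"
      unfolding k_def
      by (rule card_Un_disjoint) (auto simp: closed_nbhd_eq W_def)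
    moreover have "card ?S = card {e \<in> W. x e \<le> p}"
      by (rule card_image) (auto simp: W_def inj_on_def)
    ultimately have "k + card {e \<in> W. x e \<le> p} \<le> card (closed_nbhd G u \<inter> ?C)" by simp
    then have "(d + 1) / card (closed_nbhd G u \<inter> ?C) \<le> (d + 1) / real (k + card {e \<in> W. x e \<le> p})"
      using k by (intro divide_left_mono) auto
    then show ?thesis by (simp add: white_ratio_eq[OF uC] d_def)
  qed
  have nonneg: "0 \<le> white_ratio u C" for C by (simp add: white_ratio_def)
  \<comment> \<open>Subtraction in \<open>ennreal\<close> truncates, so 1 is added on both sides and
    cancelled at the very end.\<close>
  have "pzf_step (\<lambda>C. ennreal (white_ratio u C)) B + 1
      = (\<integral>\<^sup>+x. ennreal (white_ratio u (pzf_round G x B)) + 1 \<partial>?M)"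
    unfolding pzf_step_def
    by (subst nn_integral_add)
      (simp_all add: borel_measurable_pzf_round[OF B, of "\<lambda>C. ennreal (white_ratio u C)"] emeasure_space_1)
  also have "\<dots> = (\<integral>\<^sup>+x. ennreal (white_ratio u (pzf_round G x B) + 1) \<partial>?M)"
    by (simp add: ennreal_plus nonneg)
  also have "\<dots> \<le> (\<integral>\<^sup>+x. ennreal (d + 1) * ennreal (1 / (real k + card {e \<in> W. x e \<le> p})) \<partial>?M)"
    by (intro nn_integral_mono, subst ennreal_mult[symmetric], simp, simp) (intro ennreal_leI grow)
  also have "\<dots> = ennreal (d + 1) * (\<integral>\<^sup>+x. ennreal (1 / (real k + card {e \<in> W. x e \<le> p})) \<partial>?M)"
  proof (rule nn_integral_cmult)
    have "(\<lambda>x. real (card {e \<in> W. x e \<le> p})) \<in> borel_measurable ?M"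
      unfolding pzf_round_space_def
      by (rule borel_measurable_card_successes[OF pair_finite_arcs W p])
    then show "(\<lambda>x. ennreal (1 / (real k + card {e \<in> W. x e \<le> p}))) \<in> borel_measurable ?M"
      by (intro measurable_compose[OF _ measurable_ennreal] borel_measurable_divide borel_measurable_add) auto
  qed
  also have "\<dots> \<le> ennreal (d + 1) * ennreal ((1 - 3/10 * (card W / d)) / k)"
    unfolding pzf_round_space_def
    by (intro mult_left_mono nn_integral_inverse_card_successes_le[OF pair_finite_arcs W p _ p_eq])
      (use k d wk cW in auto)
  also have "\<dots> = ennreal ((d + 1) * ((1 - 3/10 * (w / d)) / k))"
  proof -
    have "real w / d \<le> 1" using d k wk by (simp add: divide_le_eq)
    then have "0 \<le> (1 - 3/10 * (real w / d)) / k" by (intro divide_nonneg_nonneg) auto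
    then show ?thesis unfolding cW by (intro ennreal_mult[symmetric]) auto
  qed
  also have "\<dots> \<le> ennreal (7/10 * white_ratio u B + 1)"
  proof (rule ennreal_leI)
    have "(d + 1) * ((1 - 3/10 * (w / d)) / k) = (d + 1) / real k - 3/10 * (w / k) * ((d + 1) / d)"
      using d k by (simp add: field_simps)
    also have "\<dots> \<le> (d + 1) / real k - 3/10 * (w / k) * 1"
      using d by (intro diff_left_mono mult_left_mono) auto
    also have "(d + 1) / real k = w / k + 1"
      using wk k by (simp add: field_simps flip: of_nat_add)
    finally show "(d + 1) * ((1 - 3/10 * (w / d)) / k) \<le> 7/10 * white_ratio u B + 1"
      by (simp add: white_ratio_def w_def k_def)
  qed
  also have "\<dots> = ennreal (7/10) * ennreal (white_ratio u B) + 1"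
    using nonneg[of B] by (simp add: ennreal_plus flip: ennreal_mult)
  finally show ?thesis by (simp add: ennreal_add_left_cancel_le add.commute[of _ 1])
qed

lemma pzf_step_funpow_white_ratio:
  assumes "u \<in> B" "B \<subseteq> pverts G"
  shows "(pzf_step ^^ t) (\<lambda>C. ennreal (white_ratio u C)) B \<le> ennreal ((7/10) ^ t * white_ratio u B)"
  using assms
proof (induction t arbitrary: B)
  case (Suc t)
  have nonneg: "0 \<le> white_ratio u C" for C by (simp add: white_ratio_def)
  \<comment> \<open>The new factor is gained in the last round, which starts from a superset of
    \<open>B\<close> and so with \<open>u\<close> blue.\<close>
  have "(pzf_step ^^ Suc t) (\<lambda>C. ennreal (white_ratio u C)) B
      = (pzf_step ^^ t) (pzf_step (\<lambda>C. ennreal (white_ratio u C))) B"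
    by (simp add: funpow_swap1)
  also have "\<dots> \<le> (pzf_step ^^ t) (\<lambda>C. ennreal (7/10) * ennreal (white_ratio u C)) B"
    using Suc.prems by (intro pzf_step_funpow_mono pzf_step_white_ratio) auto
  also have "\<dots> = ennreal (7/10) * (pzf_step ^^ t) (\<lambda>C. ennreal (white_ratio u C)) B"
    by (rule pzf_step_funpow_cmult[OF Suc.prems(2)])
  also have "\<dots> \<le> ennreal (7/10) * ennreal ((7/10) ^ t * white_ratio u B)"
    by (intro mult_left_mono Suc.IH Suc.prems) simp
  also have "\<dots> = ennreal ((7/10) ^ Suc t * white_ratio u B)"
    using nonneg by (simp add: mult.assoc flip: ennreal_mult)
  finally show ?case .
qed simp

section \<open>Propagation time from the distance to the blue set\<close>

text \<open>An indicator of failure: its expectation after \<open>t\<close> rounds is the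
  probability that \<open>A\<close> is not yet entirely blue.\<close>

definition missing :: "'a set \<Rightarrow> 'a set \<Rightarrow> ennreal" where
  "missing A C = (if A \<subseteq> C then 0 else 1)"

lemma missing_le_1: "missing A C \<le> 1"
  by (simp add: missing_def)

lemma missing_eq_0: "A \<subseteq> C \<Longrightarrow> missing A C = 0"
  by (simp add: missing_def)

text \<open>The \<open>j\<close>-th iterate is the ball of radius \<open>j\<close> around
  \<open>S\<close>.\<close>

definition expand :: "'a set \<Rightarrow> 'a set" where
  "expand S = S \<union> (\<Union>u\<in>S. nbhd u)"

lemma expand_subset: "S \<subseteq> pverts G \<Longrightarrow> expand S \<subseteq> pverts G"
  using nbhd_subset by (auto simp: expand_def)

lemma card_nbhd_less: "u \<in> pverts G \<Longrightarrow> card (nbhd u) < card (pverts G)"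
  using nbhd_subset[of u] nbhd_irrefl[of u]
  by (intro psubset_card_mono pair_finite_verts) (metis psubsetI)

text \<open>Markov's inequality: while a neighbor of \<open>u\<close> is white, the ratio is at
  least \<open>1 / n\<close>, with \<open>n\<close> the number of vertices. This costs one factor
  \<open>n\<close>; the other bounds the ratio at the start.\<close>

lemma pzf_step_funpow_missing_nbhd:
  assumes u: "u \<in> B" and B: "B \<subseteq> pverts G"
  shows "(pzf_step ^^ t) (missing (nbhd u)) B \<le> ennreal ((card (pverts G))\<^sup>2 * (7/10) ^ t)"
proof -
  define n where "n = card (pverts G)"
  have n: "card (nbhd u) < n" unfolding n_def using u B by (intro card_nbhd_less) auto
  have "missing (nbhd u) C \<le> ennreal n * ennreal (white_ratio u C)" if C: "B \<subseteq> C" for C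
  proof (cases "nbhd u \<subseteq> C")
    case False
    have uC: "u \<in> C" using u C by auto
    from False have "0 < card (nbhd u - C)" by (auto simp: card_gt_0_iff)
    moreover from this have "card (closed_nbhd G u \<inter> C) \<le> n"
      using card_white_plus_card_blue[OF uC] n by linarith
    ultimately have "1 * real (card (closed_nbhd G u \<inter> C)) \<le> n * card (nbhd u - C)"
      by (metis One_nat_def Suc_leI mult.commute mult_le_mono of_nat_1 of_nat_le_iff of_nat_mult)
    then have "1 \<le> n * white_ratio u C"
      using card_blue_pos[OF uC] by (simp add: white_ratio_def le_divide_eq)
    then show ?thesis
      by (simp add: missing_def False flip: ennreal_mult' ennreal_1)
  qed (simp add: missing_eq_0)
  then have "(pzf_step ^^ t) (missing (nbhd u)) B
      \<le> (pzf_step ^^ t) (\<lambda>C. ennreal n * ennreal (white_ratio u C)) B"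
    by (intro pzf_step_funpow_mono B)
  also have "\<dots> = ennreal n * (pzf_step ^^ t) (\<lambda>C. ennreal (white_ratio u C)) B"
    by (rule pzf_step_funpow_cmult[OF B])
  also have "\<dots> \<le> ennreal n * ennreal ((7/10) ^ t * white_ratio u B)"
    by (intro mult_left_mono pzf_step_funpow_white_ratio u B) simp
  also have "\<dots> \<le> ennreal n * ennreal ((7/10) ^ t * n)"
  proof (intro mult_left_mono ennreal_leI)
    have "white_ratio u B \<le> card (nbhd u - B) / 1"
      unfolding white_ratio_def using card_blue_pos[OF u] by (intro divide_left_mono) auto
    also have "\<dots> \<le> n"
      using card_mono[of "nbhd u" "nbhd u - B"] n by simp
    finally show "white_ratio u B \<le> n" .
  qed auto
  also have "\<dots> = ennreal (n\<^sup>2 * (7/10) ^ t)"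
    by (simp add: power2_eq_square ac_simps flip: ennreal_mult)
  finally show ?thesis by (simp add: n_def)
qed

text \<open>A union bound over the vertices of \<open>A\<close> contributes the third
  factor.\<close>

lemma pzf_step_funpow_missing_expand:
  assumes A: "A \<subseteq> B" and B: "B \<subseteq> pverts G"
  shows "(pzf_step ^^ t) (missing (expand A)) B \<le> ennreal (card (pverts G) ^ 3 * (7/10) ^ t)"
proof -
  define n where "n = card (pverts G)"
  have fin: "finite A" using A B pair_finite_verts by (meson finite_subset)
  have "missing (expand A) C \<le> (\<Sum>u\<in>A. missing (nbhd u) C)" if C: "B \<subseteq> C" for C
  proof (cases "expand A \<subseteq> C")
    case False
    then obtain u where u: "u \<in> A" "\<not> nbhd u \<subseteq> C" using A C by (auto simp: expand_def)
    have "missing (expand A) C = missing (nbhd u) C" using False u by (simp add: missing_def)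
    also have "\<dots> \<le> (\<Sum>u\<in>A. missing (nbhd u) C)" by (rule member_le_sum) (use u fin in auto)
    finally show ?thesis .
  qed (simp add: missing_eq_0)
  then have "(pzf_step ^^ t) (missing (expand A)) B
      \<le> (pzf_step ^^ t) (\<lambda>C. \<Sum>u\<in>A. missing (nbhd u) C) B"
    by (intro pzf_step_funpow_mono B)
  also have "\<dots> = (\<Sum>u\<in>A. (pzf_step ^^ t) (missing (nbhd u)) B)"
    by (rule pzf_step_funpow_sum[OF B])
  also have "\<dots> \<le> (\<Sum>u\<in>A. ennreal (n\<^sup>2 * (7/10) ^ t))"
    unfolding n_def using A by (intro sum_mono pzf_step_funpow_missing_nbhd B) auto
  also have "\<dots> = ennreal (card A * (n\<^sup>2 * (7/10) ^ t))"
    by (simp add: ennreal_of_nat_eq_real_of_nat flip: ennreal_mult)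
  also have "\<dots> \<le> ennreal (n * (n\<^sup>2 * (7/10) ^ t))"
    unfolding n_def using A B
    by (intro ennreal_leI mult_right_mono of_nat_mono card_mono pair_finite_verts) auto
  finally show ?thesis by (simp add: n_def power2_eq_square power3_eq_cube ac_simps)
qed

text \<open>Induction from the front: the first block of \<open>L\<close> rounds colors
  \<open>expand Z\<close>, and the remaining blocks start from the random superset reached. Hence
  both \<open>Z\<close> and \<open>B\<close> vary in the induction, and the failure probabilities of
  the blocks add up.\<close>

lemma pzf_step_funpow_missing_ball:
  assumes "Z \<subseteq> B" "B \<subseteq> pverts G"
  shows "(pzf_step ^^ (j * L)) (missing ((expand ^^ j) Z)) B
    \<le> ennreal (j * (card (pverts G) ^ 3 * (7/10) ^ L))"
  using assms
proof (induction j arbitrary: Z B)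
  case 0
  then show ?case by (simp add: missing_eq_0)
next
  case (Suc j)
  define c where "c = card (pverts G) ^ 3 * (7/10 :: real) ^ L"
  have c: "0 \<le> c" by (simp add: c_def)
  let ?f = "missing ((expand ^^ Suc j) Z)"
  have step: "(pzf_step ^^ (j * L)) ?f C \<le> missing (expand Z) C + ennreal (j * c)"
    if C: "B \<subseteq> C" "C \<subseteq> pverts G" for C
  proof (cases "expand Z \<subseteq> C")
    case True
    have "(pzf_step ^^ (j * L)) (missing ((expand ^^ j) (expand Z))) C \<le> ennreal (j * c)"
      unfolding c_def by (rule Suc.IH[OF True C(2)])
    then show ?thesis using True by (simp add: missing_eq_0 funpow_swap1)
  next
    \<comment> \<open>If the first block fails, the trivial bound 1 is used, and the summand
      \<open>missing (expand Z) C\<close> pays for it.\<close>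
    case False
    have "(pzf_step ^^ (j * L)) ?f C \<le> 1"
      by (rule pzf_step_funpow_le_const[OF missing_le_1 C(2)])
    also have "1 \<le> missing (expand Z) C + ennreal (j * c)" using False by (simp add: missing_def)
    finally show ?thesis .
  qed
  have "(pzf_step ^^ (Suc j * L)) ?f B = (pzf_step ^^ L) ((pzf_step ^^ (j * L)) ?f) B"
    by (simp only: mult_Suc pzf_step_funpow_add)
  also have "\<dots> \<le> (pzf_step ^^ L) (\<lambda>C. missing (expand Z) C + ennreal (j * c)) B"
    by (rule pzf_step_funpow_mono[OF step Suc.prems(2)])
  also have "\<dots> = (pzf_step ^^ L) (missing (expand Z)) B + ennreal (j * c)"
    by (rule pzf_step_funpow_add_const[OF Suc.prems(2)])
  also have "\<dots> \<le> ennreal c + ennreal (j * c)"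
    unfolding c_def by (intro add_mono pzf_step_funpow_missing_expand Suc.prems order_refl)
  also have "\<dots> = ennreal (Suc j * c)"
    using c by (simp add: algebra_simps flip: ennreal_plus)
  finally show ?case by (simp only: c_def)
qed

section \<open>From failure probabilities to the expected time\<close>

text \<open>The tail-sum formula for the expectation; a propagation time above \<open>t\<close>
  means that some vertex is white after \<open>t\<close> rounds.\<close>

lemma ept_pzf_le_suminf:
  assumes Z: "Z \<subseteq> pverts G"
  shows "ept_pzf G Z \<le> (\<Sum>t. (pzf_step ^^ t) (missing (pverts G)) Z)"
proof -
  have [measurable]: "pt_pzf G Z \<in> pzf_space G \<rightarrow>\<^sub>M count_space UNIV"
    by (rule measurable_pt_pzf[OF pair_graph_axioms Z])
  have "emeasure (pzf_space G) {\<omega> \<in> space (pzf_space G). enat t < pt_pzf G Z \<omega>}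
      \<le> (pzf_step ^^ t) (missing (pverts G)) Z" for t
  proof -
    let ?S = "{\<omega> \<in> space (pzf_space G). enat t < pt_pzf G Z \<omega>}"
    have "emeasure (pzf_space G) ?S = (\<integral>\<^sup>+\<omega>. indicator ?S \<omega> \<partial>pzf_space G)"
      by (rule nn_integral_indicator[symmetric]) measurable
    also have "\<dots> \<le> (\<integral>\<^sup>+\<omega>. missing (pverts G) (pzf_blue G Z \<omega> t) \<partial>pzf_space G)"
    proof (rule nn_integral_mono)
      fix \<omega>
      have "pzf_blue G Z \<omega> t \<noteq> pverts G" if "enat t < pt_pzf G Z \<omega>"
      proof
        assume "pzf_blue G Z \<omega> t = pverts G"
        then have "pt_pzf G Z \<omega> \<le> enat t" unfolding pt_pzf_def by (intro INF_lower) simp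
        with that show False by simp
      qed
      then show "indicator ?S \<omega> \<le> missing (pverts G) (pzf_blue G Z \<omega> t)"
        using pzf_blue_subset[OF Z, of \<omega> t] by (auto simp: indicator_def missing_def)
    qed
    also have "\<dots> = (pzf_step ^^ t) (missing (pverts G)) Z"
      by (rule nn_integral_pzf_blue[OF Z])
    finally show ?thesis .
  qed
  then show ?thesis
    unfolding ept_pzf_def
    by (subst nn_integral_enat_function) (auto intro!: suminf_le summableI)
qed

lemma pzf_step_funpow_missing_verts_antimono:
  assumes "s \<le> t" and B: "B \<subseteq> pverts G"
  shows "(pzf_step ^^ t) (missing (pverts G)) B \<le> (pzf_step ^^ s) (missing (pverts G)) B"
proof -
  have "(pzf_step ^^ (t - s)) (missing (pverts G)) C \<le> missing (pverts G) C"
    if C: "C \<subseteq> pverts G" for C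
  proof (rule pzf_step_funpow_le_const[OF _ C])
    fix D assume "C \<subseteq> D"
    then show "missing (pverts G) D \<le> missing (pverts G) C" by (auto simp: missing_def)
  qed
  then have "(pzf_step ^^ s) ((pzf_step ^^ (t - s)) (missing (pverts G))) B
      \<le> (pzf_step ^^ s) (missing (pverts G)) B"
    by (intro pzf_step_funpow_mono B)
  then show ?thesis using assms(1) by (simp flip: pzf_step_funpow_add)
qed

text \<open>The assumption covers every superset of \<open>Z\<close>, so it applies afresh to
  whatever blue set a period ends with. Once everything is blue, failure has probability 0, which
  allows the multiplicative form of the step.\<close>

lemma pzf_step_funpow_missing_verts_geometric:
  assumes Z: "Z \<subseteq> pverts G"
    and half: "\<And>B. Z \<subseteq> B \<Longrightarrow> B \<subseteq> pverts G \<Longrightarrow> (pzf_step ^^ T) (missing (pverts G)) B \<le> ennreal (1/2)"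
  shows "(pzf_step ^^ (k * T)) (missing (pverts G)) Z \<le> ennreal ((1/2) ^ k)"
proof (induction k)
  case 0
  show ?case by (simp add: missing_le_1)
next
  case (Suc k)
  let ?g = "missing (pverts G)"
  have step: "(pzf_step ^^ T) ?g B \<le> ennreal (1/2) * ?g B" if B: "Z \<subseteq> B" "B \<subseteq> pverts G" for B
  proof (cases "pverts G \<subseteq> B")
    case True
    have "(pzf_step ^^ T) ?g B \<le> 0"
      by (rule pzf_step_funpow_le_const[OF _ B(2)]) (use True in \<open>auto simp: missing_def\<close>)
    then show ?thesis by simp
  qed (use half[OF B] in \<open>simp add: missing_def\<close>)
  have "(pzf_step ^^ (Suc k * T)) ?g Z = (pzf_step ^^ (k * T)) ((pzf_step ^^ T) ?g) Z"
    by (simp only: mult_Suc add.commute[of T] pzf_step_funpow_add)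
  also have "\<dots> \<le> (pzf_step ^^ (k * T)) (\<lambda>B. ennreal (1/2) * ?g B) Z"
    by (rule pzf_step_funpow_mono[OF step Z])
  also have "\<dots> = ennreal (1/2) * (pzf_step ^^ (k * T)) ?g Z"
    by (rule pzf_step_funpow_cmult[OF Z])
  also have "\<dots> \<le> ennreal (1/2) * ennreal ((1/2) ^ k)"
    by (intro mult_left_mono Suc.IH) simp
  also have "\<dots> = ennreal ((1/2) ^ Suc k)"
    by (subst ennreal_mult[symmetric]) simp_all
  finally show ?case .
qed

text \<open>In the period with index \<open>m\<close> each of the \<open>T\<close> summands is at
  most \<open>(1/2) ^ m\<close>, and the geometric series sums to at most 2.\<close>

lemma ept_pzf_le_of_half:
  assumes Z: "Z \<subseteq> pverts G" and T: "0 < T"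
    and half: "\<And>B. Z \<subseteq> B \<Longrightarrow> B \<subseteq> pverts G \<Longrightarrow> (pzf_step ^^ T) (missing (pverts G)) B \<le> ennreal (1/2)"
  shows "ept_pzf G Z \<le> ennreal (2 * T)"
proof -
  let ?a = "\<lambda>t. (pzf_step ^^ t) (missing (pverts G)) Z"
  have partial: "(\<Sum>t<N. ?a t) \<le> ennreal (2 * T)" for N
  proof -
    \<comment> \<open>The range is enlarged to \<open>N\<close> complete periods.\<close>
    have "(\<Sum>t<N. ?a t) \<le> (\<Sum>t<N * T. ?a t)"
      by (rule sum_mono2) (use T in auto)
    also have "\<dots> = (\<Sum>m<N. \<Sum>t=m * T..<m * T + T. ?a t)"
      by (rule sum.nat_group[symmetric])
    also have "\<dots> \<le> (\<Sum>m<N. \<Sum>t=m * T..<m * T + T. ennreal ((1/2) ^ m))"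
    proof (intro sum_mono)
      fix m t assume "t \<in> {m * T..<m * T + T}"
      then have "?a t \<le> ?a (m * T)"
        using Z by (intro pzf_step_funpow_missing_verts_antimono) auto
      also have "\<dots> \<le> ennreal ((1/2) ^ m)"
        by (rule pzf_step_funpow_missing_verts_geometric[OF Z half])
      finally show "?a t \<le> ennreal ((1/2) ^ m)" .
    qed
    also have "\<dots> = ennreal (\<Sum>m<N. T * (1/2) ^ m)"
      by (simp add: ennreal_of_nat_eq_real_of_nat sum_ennreal flip: ennreal_mult)
    also have "\<dots> \<le> ennreal (2 * T)"
    proof (rule ennreal_leI)
      have "(\<Sum>m<N. (1/2 :: real) ^ m) \<le> 2" by (simp add: sum_gp_strict)
      then have "T * (\<Sum>m<N. (1/2 :: real) ^ m) \<le> real T * 2" by (intro mult_left_mono) auto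
      then show "(\<Sum>m<N. T * (1/2 :: real) ^ m) \<le> 2 * T" by (simp add: sum_distrib_left)
    qed
    finally show ?thesis .
  qed
  have "ept_pzf G Z \<le> (\<Sum>t. ?a t)" by (rule ept_pzf_le_suminf[OF Z])
  also have "\<dots> \<le> ennreal (2 * T)" by (rule suminf_le_const[OF summableI partial])
  finally show ?thesis .
qed

lemma ept_pzf_le_of_ball:
  assumes Z: "Z \<subseteq> pverts G" and ball: "(expand ^^ r) Z = pverts G" and rL: "0 < r" "0 < L"
    and small: "r * (card (pverts G) ^ 3 * (7/10) ^ L) \<le> (1/2 :: real)"
  shows "ept_pzf G Z \<le> ennreal (2 * (r * L))"
proof -
  have "(pzf_step ^^ (r * L)) (missing (pverts G)) B \<le> ennreal (1/2)"
    if B: "Z \<subseteq> B" "B \<subseteq> pverts G" for B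
    using pzf_step_funpow_missing_ball[OF B, of r L] ennreal_leI[OF small]
    unfolding ball by (rule order_trans)
  then show ?thesis
    using ept_pzf_le_of_half[OF Z, of "r * L"] rL by simp
qed

section \<open>Distance domination\<close>

lemma expand_mono: "A \<subseteq> B \<Longrightarrow> expand A \<subseteq> expand B"
  by (auto simp: expand_def)

lemma expand_funpow_mono: "A \<subseteq> B \<Longrightarrow> (expand ^^ k) A \<subseteq> (expand ^^ k) B"
  by (induction k) (simp_all add: expand_mono)

lemma expand_funpow_subset: "A \<subseteq> pverts G \<Longrightarrow> (expand ^^ k) A \<subseteq> pverts G"
  by (induction k) (simp_all add: expand_subset)

lemma expand_funpow_increasing:
  assumes "s \<le> t"
  shows "(expand ^^ s) A \<subseteq> (expand ^^ t) A"
  using assms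
proof (induction rule: dec_induct)
  case (step t)
  then show ?case by (auto simp: expand_def)
qed simp

text \<open>Here \<open>\<delta> v\<close> is the distance from \<open>r\<close>, the radius of the
  first ball that contains \<open>v\<close>. Only the two properties needed to walk back towards the
  root are kept.\<close>

lemma ex_dist_function:
  assumes conn: "Digraph_Component.connected (with_proj G)" and r: "r \<in> pverts G"
  obtains \<delta> :: "'a \<Rightarrow> nat"
  where "\<And>v. v \<in> pverts G \<Longrightarrow> \<delta> v = 0 \<Longrightarrow> v = r"
    and "\<And>v m. v \<in> pverts G \<Longrightarrow> \<delta> v = Suc m \<Longrightarrow> \<exists>u\<in>pverts G. \<delta> u = m \<and> v \<in> nbhd u"
proof -
  let ?b = "\<lambda>j. (expand ^^ j) {r}"
  define \<delta> where "\<delta> v = (LEAST j. v \<in> ?b j)" for v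
  have sub: "?b j \<subseteq> pverts G" for j using r by (intro expand_funpow_subset) auto
  have reach: "\<exists>j. v \<in> ?b j" if v: "v \<in> pverts G" for v
  proof -
    have "(r, v) \<in> rtrancl_on (pverts G) ((parcs G)\<^sup>s)"
      using conn r v unfolding connected_conv by simp
    then show ?thesis
    proof (induction rule: rtrancl_on_induct)
      case base
      have "r \<in> ?b 0" by simp
      then show ?case by blast
    next
      case (step y z)
      then obtain j where j: "y \<in> ?b j" by blast
      have "z \<in> nbhd y"
        using step.hyps(2) nbhd_sym[of y z] by (auto simp: symcl_def nbhd_def)
      with j have "z \<in> ?b (Suc j)" by (auto simp: expand_def)
      then show ?case by blast
    qed
  qed
  have mem: "v \<in> ?b (\<delta> v)" if "v \<in> pverts G" for v
    unfolding \<delta>_def using reach[OF that] by (rule LeastI_ex)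
  have least: "\<delta> v \<le> j" if "v \<in> ?b j" for v j
    unfolding \<delta>_def using that by (rule Least_le)
  show ?thesis
  proof (rule that[of \<delta>])
    fix v assume "v \<in> pverts G" "\<delta> v = 0"
    then show "v = r" using mem[of v] by simp
  next
    fix v m assume v: "v \<in> pverts G" and m: "\<delta> v = Suc m"
    have notin: "v \<notin> ?b m" using least[of v m] m by auto
    have "v \<in> expand (?b m)" using mem[OF v] m by simp
    then obtain u where u: "u \<in> ?b m" "v \<in> nbhd u" using notin by (auto simp: expand_def)
    have "\<delta> u = m"
    proof (rule antisym)
      show "\<delta> u \<le> m" by (rule least[OF u(1)])
      have "u \<in> ?b (\<delta> u)" using u(1) sub by (intro mem) auto
      then have "v \<in> ?b (Suc (\<delta> u))" using u(2) by (auto simp: expand_def)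
      then show "m \<le> \<delta> u" using least[of v "Suc (\<delta> u)"] m by simp
    qed
    then show "\<exists>u\<in>pverts G. \<delta> u = m \<and> v \<in> nbhd u" using u sub by blast
  qed
qed

text \<open>Take the root together with the smallest class of vertices whose distances from the root agree modulo \<open>k\<close>.\<close>
lemma ex_distance_dominating_set:
  assumes conn: "Digraph_Component.connected (with_proj G)" and k: "0 < k"
  obtains Z where "Z \<noteq> {}" "Z \<subseteq> pverts G" "k * card Z \<le> card (pverts G) + k"
    "(expand ^^ k) Z = pverts G"
proof -
  from conn obtain r where r: "r \<in> pverts G" by (auto simp: connected_conv)
  obtain \<delta> :: "'a \<Rightarrow> nat" where \<delta>0: "\<And>v. v \<in> pverts G \<Longrightarrow> \<delta> v = 0 \<Longrightarrow> v = r"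
    and \<delta>_Suc: "\<And>v m. v \<in> pverts G \<Longrightarrow> \<delta> v = Suc m \<Longrightarrow> \<exists>u\<in>pverts G. \<delta> u = m \<and> v \<in> nbhd u"
    using ex_dist_function[OF conn r] by blast
  have walk: "\<exists>u\<in>pverts G. \<delta> u = \<delta> v - s \<and> v \<in> (expand ^^ s) {u}"
    if "v \<in> pverts G" "s \<le> \<delta> v" for v s
    using that
  proof (induction s arbitrary: v)
    case (Suc s)
    then obtain m where m: "\<delta> v = Suc m" by (cases "\<delta> v") auto
    obtain y where y: "y \<in> pverts G" "\<delta> y = m" "v \<in> nbhd y" using \<delta>_Suc[OF Suc.prems(1) m] by blast
    have "s \<le> \<delta> y" using Suc.prems(2) m y by simp
    then obtain u where u: "u \<in> pverts G" "\<delta> u = \<delta> y - s" "y \<in> (expand ^^ s) {u}"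
      using Suc.IH[OF y(1)] by blast
    have "v \<in> (expand ^^ Suc s) {u}" using u(3) y(3) by (auto simp: expand_def)
    with u m y show ?case by (intro bexI[of _ u]) auto
  qed auto
  define K where "K i = {v \<in> pverts G. \<delta> v mod k = i}" for i
  \<comment> \<open>The \<open>k\<close> classes partition the vertices, so they cannot all exceed
    the average size.\<close>
  have "\<exists>i<k. k * card (K i) \<le> card (pverts G)"
  proof (rule ccontr)
    assume "\<not> ?thesis"
    then have "(\<Sum>i<k. card (pverts G)) < (\<Sum>i<k. k * card (K i))"
      using k by (intro sum_strict_mono) (auto simp: not_le)
    also have "\<dots> = k * card (\<Union>i<k. K i)"
      unfolding sum_distrib_left[symmetric]
      by (subst card_UN_disjoint) (auto simp: K_def pair_finite_verts)
    also have "(\<Union>i<k. K i) = pverts G" using k by (auto simp: K_def)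
    finally show False by simp
  qed
  then obtain i where i: "i < k" "k * card (K i) \<le> card (pverts G)" by blast
  let ?Z = "insert r (K i)"
  have Z: "?Z \<subseteq> pverts G" using r by (auto simp: K_def)
  have "finite (K i)" by (simp add: K_def pair_finite_verts)
  then have "card ?Z \<le> card (K i) + 1" by (simp add: card_insert_if)
  then have "k * card ?Z \<le> k * (card (K i) + 1)" by (rule mult_le_mono2)
  then have card: "k * card ?Z \<le> card (pverts G) + k" using i(2) by simp
  have "pverts G \<subseteq> (expand ^^ k) ?Z"
  proof
    fix v assume v: "v \<in> pverts G"
    have "\<exists>s\<le>k. \<exists>u\<in>?Z. v \<in> (expand ^^ s) {u}"
    proof (cases "i \<le> \<delta> v")
      case True
      \<comment> \<open>Going back \<open>s\<close> steps leads to the largest distance up to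
        \<open>\<delta> v\<close> that is congruent to \<open>i\<close> modulo
        \<open>k\<close>.\<close>
      define s where "s = (\<delta> v - i) mod k"
      have s: "s < k" "s \<le> \<delta> v - i" using k by (auto simp: s_def)
      have "s \<le> \<delta> v" using s by simp
      then obtain u where u: "u \<in> pverts G" "\<delta> u = \<delta> v - s" "v \<in> (expand ^^ s) {u}"
        using walk[OF v] by blast
      have "\<delta> v - i = k * ((\<delta> v - i) div k) + s" by (simp add: s_def)
      then have "\<delta> v - s = i + k * ((\<delta> v - i) div k)" using True by linarith
      then have "\<delta> u mod k = i" using u(2) i(1) by simp
      then show ?thesis using u s(1) by (intro exI[of _ s]) (auto simp: K_def)
    next
      case False
      \<comment> \<open>Closer to the root than \<open>i\<close>, walking back meets no vertex of
        \<open>K i\<close>; the root itself is then fewer than \<open>k\<close> steps away. This is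
        why it was added to the class.\<close>
      obtain u where u: "u \<in> pverts G" "\<delta> u = \<delta> v - \<delta> v" "v \<in> (expand ^^ \<delta> v) {u}"
        using walk[OF v order_refl] by blast
      then have "u = r" using \<delta>0 by simp
      then show ?thesis using u False i(1) by (intro exI[of _ "\<delta> v"]) auto
    qed
    then obtain s u where "s \<le> k" "u \<in> ?Z" "v \<in> (expand ^^ s) {u}" by blast
    moreover have "(expand ^^ s) {u} \<subseteq> (expand ^^ k) {u}" using \<open>s \<le> k\<close> by (rule expand_funpow_increasing)
    moreover have "(expand ^^ k) {u} \<subseteq> (expand ^^ k) ?Z" using \<open>u \<in> ?Z\<close> by (intro expand_funpow_mono) auto
    ultimately show "v \<in> (expand ^^ k) ?Z" by blast
  qed
  with expand_funpow_subset[OF Z, of k] have "(expand ^^ k) ?Z = pverts G" by (rule antisym)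
  then show ?thesis using that[of ?Z] Z card by simp
qed

lemma th_pzf_le:
  assumes "Z \<noteq> {}" "Z \<subseteq> pverts G"
  shows "th_pzf G \<le> of_nat (card Z) + ept_pzf G Z"
  unfolding th_pzf_def
  by (rule Min_le) (use assms pair_finite_verts in auto)

lemma th_pzf_le_sqrt_mult_ln:
  assumes conn: "Digraph_Component.connected (with_proj G)" and n: "n = card (pverts G)" "3 \<le> n"
  shows "th_pzf G \<le> ennreal (86 * (sqrt n * ln n))"
proof -
  define k where "k = nat \<lceil>sqrt n\<rceil>"
  \<comment> \<open>Since \<open>7/10 \<le> exp (- (3/10))\<close>, the factor 20 makes
    \<open>(7/10) ^ L\<close> at most \<open>1 / n ^ 6\<close>. This beats the
    \<open>k * n ^ 3\<close> of the union bounds, where \<open>k \<le> n\<close>, and leaves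
    \<open>1 / n ^ 2\<close>.\<close>
  define L where "L = nat \<lceil>20 * ln n\<rceil>"
  have ln1: "1 \<le> ln (real n)"
  proof -
    have "exp 1 \<le> real n" using exp_le n(2) by linarith
    then show ?thesis using n(2) by (simp add: ln_ge_iff)
  qed
  have sq1: "1 \<le> sqrt n" using n(2) by simp
  have k: "sqrt n \<le> k" "k \<le> sqrt n + 1" using sq1 unfolding k_def by linarith+
  have L: "20 * ln n \<le> L" "L \<le> 20 * ln n + 1" using ln1 unfolding L_def by linarith+
  have "0 < real k" "0 < real L" using sq1 ln1 k(1) L(1) by linarith+
  then have pos: "0 < k" "0 < L" by simp_all
  obtain Z where Z: "Z \<noteq> {}" "Z \<subseteq> pverts G" "k * card Z \<le> card (pverts G) + k"
    "(expand ^^ k) Z = pverts G"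
    using ex_distance_dominating_set[OF conn pos(1)] by blast
  have "k \<le> n"
  proof -
    have "real k < n + 1" using k(2) real_sqrt_less_mono[of n "n\<^sup>2"] n(2)
      by (simp add: power2_eq_square)
    then show ?thesis by linarith
  qed
  have "(7/10 :: real) ^ L \<le> (exp (- (3/10))) ^ L"
    by (intro power_mono) (use exp_ge_add_one_self[of "- (3/10) :: real"] in auto)
  also have "\<dots> = exp (- (3/10 * L))" by (simp flip: exp_of_nat_mult add: mult.commute)
  also have "\<dots> \<le> exp (- (6 * ln n))" using L(1) by simp
  also have "\<dots> = 1 / n ^ 6"
    using n(2) exp_of_nat_mult[of 6 "ln (real n)"] by (simp add: exp_minus inverse_eq_divide)
  finally have decay: "(7/10 :: real) ^ L \<le> 1 / n ^ 6" .
  have "k * (n ^ 3 * (7/10 :: real) ^ L) \<le> n * (n ^ 3 * (1 / n ^ 6))"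
    using \<open>k \<le> n\<close> decay by (intro mult_mono mult_left_mono) auto
  also have "\<dots> = 1 / n\<^sup>2" using n(2) by (simp add: field_simps eval_nat_numeral)
  also have "\<dots> \<le> 1/2" using mult_mono[of 3 "real n" 3 "real n"] n(2) by (simp add: field_simps power2_eq_square)
  finally have small: "k * (card (pverts G) ^ 3 * (7/10 :: real) ^ L) \<le> 1/2" by (simp add: n(1))
  have card: "card Z \<le> sqrt n + 1"
  proof -
    have "real k * card Z \<le> n + k" using Z(3) n(1) by (simp flip: of_nat_mult of_nat_add)
    then have "card Z \<le> n / k + 1" using pos(1) by (simp add: field_simps)
    also have "n / k \<le> n / sqrt n" using k(1) sq1 pos(1) by (intro divide_left_mono mult_pos_pos) auto
    also have "\<dots> = sqrt n" by (simp add: real_div_sqrt)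
    finally show ?thesis by simp
  qed
  have "th_pzf G \<le> ennreal (card Z) + ennreal (2 * (k * L))"
    using th_pzf_le[OF Z(1,2)] ept_pzf_le_of_ball[OF Z(2,4) pos small]
    by (simp add: ennreal_of_nat_eq_real_of_nat) (meson add_left_mono order_trans)
  also have "\<dots> = ennreal (card Z + 2 * (k * L))" by (simp flip: ennreal_plus)
  also have "\<dots> \<le> ennreal (86 * (sqrt n * ln n))"
  proof (rule ennreal_leI)
    \<comment> \<open>As \<open>sqrt n\<close> and \<open>ln n\<close> are at least 1, they absorb
      the roundings: \<open>2 * k * L\<close> takes 84 of the 86, and
      \<open>card Z \<le> 2 * sqrt n\<close> the other 2.\<close>
    have "real k * L \<le> (2 * sqrt n) * (21 * ln n)"
      using k L sq1 ln1 by (intro mult_mono) linarith+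
    then have "real k * L \<le> 42 * (sqrt n * ln n)" by simp
    moreover have "sqrt n \<le> sqrt n * ln n" using ln1 sq1 by (simp add: mult_le_cancel_left1)
    ultimately have "card Z + 2 * (real k * L) \<le> 86 * (sqrt n * ln n)" using card sq1 by linarith
    then show "card Z + 2 * (k * L) \<le> 86 * (sqrt n * ln n)" by simp
  qed
  finally show ?thesis .
qed

end

section \<open>Paths\<close>

definition path_graph :: "nat \<Rightarrow> nat pair_pre_digraph" where
  "path_graph n = \<lparr>pverts = {..<n}, parcs = {(u, v). u < n \<and> v < n \<and> (v = Suc u \<or> u = Suc v)}\<rparr>"

lemma pair_graph_path_graph: "pair_graph (path_graph n)"
proof
  show "finite (parcs (path_graph n))"
    by (rule finite_subset[of _ "{..<n} \<times> {..<n}"]) (auto simp: path_graph_def)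
qed (auto simp: path_graph_def symmetric_def sym_def)

lemma path_graph_in_connected_graphs:
  assumes "0 < n"
  shows "path_graph n \<in> connected_graphs n"
proof -
  let ?R = "rtrancl_on {..<n} ((parcs (path_graph n))\<^sup>s)"
  have from0: "(0, v) \<in> ?R" if "v < n" for v
    using that
  proof (induction v)
    case (Suc v)
    have "(v, Suc v) \<in> (parcs (path_graph n))\<^sup>s"
      using Suc.prems by (auto simp: symcl_def path_graph_def)
    with Suc show ?case by (metis Suc_lessD lessThan_iff rtrancl_on_into_rtrancl_on)
  qed (use assms in auto)
  have "sym ((parcs (path_graph n))\<^sup>s)" by (auto simp: symcl_def sym_def)
  then have "sym ?R" by (rule rtrancl_on_sym)
  then have "(u, v) \<in> ?R" if "u < n" "v < n" for u v
    using from0 that by (meson rtrancl_on_trans symD)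
  then have "Digraph_Component.connected (with_proj (path_graph n))"
    unfolding connected_conv using assms by (auto simp: path_graph_def)
  then show ?thesis
    using pair_graph_path_graph by (simp add: connected_graphs_def) (simp add: path_graph_def)
qed

text \<open>Labels change by one along an arc, so blue spreads by at most one in either direction
  per round. Truncation of \<open>z - t\<close> at 0 agrees with the end of the path.\<close>

lemma pzf_blue_path_graph_subset:
  "pzf_blue (path_graph n) Z \<omega> t \<subseteq> (\<Union>z\<in>Z. {z - t..z + t})"
proof (induction t)
  case (Suc t)
  show ?case
  proof
    fix v assume "v \<in> pzf_blue (path_graph n) Z \<omega> (Suc t)"
    then obtain u where u: "u \<in> pzf_blue (path_graph n) Z \<omega> t" "v = u \<or> v = Suc u \<or> u = Suc v"
      by (auto simp: pzf_round_def path_graph_def)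
    with Suc.IH obtain z where "z \<in> Z" "z - t \<le> u" "u \<le> z + t" by auto
    with u(2) show "v \<in> (\<Union>z\<in>Z. {z - Suc t..z + Suc t})" by (intro UN_I[of z]) auto
  qed
qed auto

lemma card_le_of_pzf_blue_path_graph:
  assumes "finite Z" and "pzf_blue (path_graph n) Z \<omega> t = {..<n}"
  shows "n \<le> card Z * (2 * t + 1)"
proof -
  have "n \<le> card (\<Union>z\<in>Z. {z - t..z + t})"
    using card_mono[OF _ pzf_blue_path_graph_subset[of n Z \<omega> t]] assms by simp
  also have "\<dots> \<le> (\<Sum>z\<in>Z. card {z - t..z + t})" by (rule card_UN_le[OF assms(1)])
  also have "\<dots> \<le> (\<Sum>z\<in>Z. 2 * t + 1)" by (rule sum_mono) simp
  finally show ?thesis by simp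
qed

text \<open>The bound holds for every outcome: by counting if the propagation time is finite, and
  trivially if it is infinite.\<close>

lemma ept_pzf_path_graph_ge:
  assumes Z: "finite Z" "Z \<noteq> {}"
  shows "ennreal ((n / card Z - 1) / 2) \<le> ept_pzf (path_graph n) Z"
proof -
  interpret prob_space "pzf_space (path_graph n)" by (rule prob_space_pzf_space)
  have z: "0 < card Z" using Z by (simp add: card_gt_0_iff)
  have "ennreal ((n / card Z - 1) / 2) \<le> ennreal_of_enat (pt_pzf (path_graph n) Z \<omega>)" for \<omega>
  proof (cases "pt_pzf (path_graph n) Z \<omega>")
    case (enat t)
    let ?T = "{t. pzf_blue (path_graph n) Z \<omega> t = pverts (path_graph n)}"
    have "?T \<noteq> {}"
    proof
      assume "?T = {}"
      then have "pt_pzf (path_graph n) Z \<omega> = Inf {}" by (simp only: pt_pzf_def image_empty)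
      then show False using enat by (simp add: top_enat_def)
    qed
    then obtain x where "x \<in> enat ` ?T" by blast
    then have "Inf (enat ` ?T) \<in> enat ` ?T" by (rule wellorder_InfI)
    then have "t \<in> ?T" using enat by (auto simp: pt_pzf_def)
    then have "n \<le> card Z * (2 * t + 1)"
      by (intro card_le_of_pzf_blue_path_graph[OF Z(1)]) (simp add: path_graph_def)
    then have "real n \<le> card Z * (2 * t + 1)" by (simp only: of_nat_le_iff flip: of_nat_mult)
    then have "(n / card Z - 1) / 2 \<le> t" using z by (simp add: field_simps)
    then show ?thesis using enat by (simp add: ennreal_of_nat_eq_real_of_nat ennreal_leI)
  qed simp
  then have "(\<integral>\<^sup>+\<omega>. ennreal ((n / card Z - 1) / 2) \<partial>pzf_space (path_graph n)) \<le> ept_pzf (path_graph n) Z"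
    unfolding ept_pzf_def by (intro nn_integral_mono)
  then show ?thesis by (simp add: emeasure_space_1)
qed

lemma th_pzf_path_graph_ge:
  assumes n: "0 < n"
  shows "ennreal (sqrt n / 2) \<le> th_pzf (path_graph n)"
  unfolding th_pzf_def
proof (rule Min.boundedI)
  let ?S = "{Z. Z \<noteq> {} \<and> Z \<subseteq> pverts (path_graph n)}"
  have V: "pverts (path_graph n) = {..<n}" by (simp add: path_graph_def)
  show "finite ((\<lambda>Z. of_nat (card Z) + ept_pzf (path_graph n) Z) ` ?S)" by (simp add: V)
  show "(\<lambda>Z. of_nat (card Z) + ept_pzf (path_graph n) Z) ` ?S \<noteq> {}" using n by (auto simp: V)
  fix a assume "a \<in> (\<lambda>Z. of_nat (card Z) + ept_pzf (path_graph n) Z) ` ?S"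
  then obtain Z where Z: "Z \<noteq> {}" "Z \<subseteq> {..<n}" and a: "a = of_nat (card Z) + ept_pzf (path_graph n) Z"
    by (auto simp: V)
  have fin: "finite Z" using Z(2) by (rule finite_subset) simp
  define z where "z = real (card Z)"
  have z: "0 < z" using fin Z(1) by (simp add: z_def card_gt_0_iff)
  have zn: "z \<le> n" using card_mono[OF _ Z(2)] by (simp add: z_def)
  \<comment> \<open>Divided by \<open>z\<close>, the completed square gives
    \<open>sqrt n \<le> z + n / (2 * z)\<close>.\<close>
  have "0 \<le> (z - sqrt n / 2)\<^sup>2 + n / 4" by simp
  also have "\<dots> = z\<^sup>2 - z * sqrt n + n / 2"
    by (simp add: power2_diff power_divide)
  finally have "sqrt n \<le> z + (n / z) / 2" using z by (simp add: field_simps power2_eq_square)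
  \<comment> \<open>This absorbs the \<open>1/2\<close> lost in the path bound, at the price of half
    of \<open>sqrt n\<close>.\<close>
  moreover have "1 \<le> sqrt n" using n by simp
  ultimately have "sqrt n / 2 \<le> z + (n / z - 1) / 2" unfolding diff_divide_distrib by linarith
  then have "ennreal (sqrt n / 2) \<le> ennreal (z + (n / z - 1) / 2)" by (rule ennreal_leI)
  also have "\<dots> = ennreal z + ennreal ((n / z - 1) / 2)"
    using z zn by (intro ennreal_plus) (auto simp: field_simps)
  also have "\<dots> \<le> a"
    unfolding a z_def using ept_pzf_path_graph_ge[OF fin Z(1), of n]
    by (intro add_mono) (auto simp: ennreal_of_nat_eq_real_of_nat)
  finally show "ennreal (sqrt n / 2) \<le> a" .
qed

section \<open>Bounds for the maximum over all connected graphs\<close>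

lemma max_th_pzf_le:
  assumes "3 \<le> n"
  shows "max_th_pzf n \<le> ennreal (86 * (sqrt n * ln n))"
  unfolding max_th_pzf_def
proof (rule Max.boundedI)
  show "finite (th_pzf ` connected_graphs n)" using finite_connected_graphs by simp
  show "th_pzf ` connected_graphs n \<noteq> {}" using connected_graphs_nonempty[of n] assms by simp
  fix a assume "a \<in> th_pzf ` connected_graphs n"
  then obtain G where G: "pair_graph G" "Digraph_Component.connected (with_proj G)" "pverts G = {..<n}"
    and a: "a = th_pzf G" by (auto simp: connected_graphs_def)
  show "a \<le> ennreal (86 * (sqrt n * ln n))"
    unfolding a by (rule pair_graph.th_pzf_le_sqrt_mult_ln[OF G(1,2) _ assms]) (simp add: G(3))
qed

lemma max_th_pzf_ge:
  assumes "0 < n"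
  shows "ennreal (sqrt n / 2) \<le> max_th_pzf n"
proof -
  have "th_pzf (path_graph n) \<le> max_th_pzf n"
    unfolding max_th_pzf_def using path_graph_in_connected_graphs[OF assms] finite_connected_graphs
    by (intro Max_ge) auto
  with th_pzf_path_graph_ge[OF assms] show ?thesis by (rule order_trans)
qed

theorem theorem6p5:
  shows "(\<lambda>n. enn2real (max_th_pzf n)) \<in> \<Omega>(\<lambda>n. sqrt (real n))
       \<and> (\<lambda>n. enn2real (max_th_pzf n)) \<in> O(\<lambda>n. sqrt (real n) * (ln (real n))\<^sup>2)"
proof
  have bounds: "sqrt n / 2 \<le> enn2real (max_th_pzf n) \<and> enn2real (max_th_pzf n) \<le> 86 * (sqrt n * ln n)"
    if n: "3 \<le> n" for n
  proof
    \<comment> \<open>\<open>enn2real\<close> sends infinity to 0, so the lower bound passes to real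
      numbers only once the maximum is known to be finite.\<close>
    have "max_th_pzf n < \<infinity>" using max_th_pzf_le[OF n] by (rule order_le_less_trans) simp
    then have "enn2real (ennreal (sqrt n / 2)) \<le> enn2real (max_th_pzf n)"
      using max_th_pzf_ge[of n] n by (intro enn2real_mono) auto
    then show "sqrt n / 2 \<le> enn2real (max_th_pzf n)" by simp
    have "0 \<le> ln (real n)" using n by simp
    then show "enn2real (max_th_pzf n) \<le> 86 * (sqrt n * ln n)"
      using max_th_pzf_le[OF n] by (intro enn2real_leI) auto
  qed
  show "(\<lambda>n. enn2real (max_th_pzf n)) \<in> \<Omega>(\<lambda>n. sqrt (real n))"
  proof (rule landau_omega.bigI[of "1/2"])
    show "\<forall>\<^sub>F n in sequentially. 1/2 * norm (sqrt (real n)) \<le> norm (enn2real (max_th_pzf n))"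
      using eventually_ge_at_top[of 3] by eventually_elim (use bounds in auto)
  qed simp
  \<comment> \<open>The argument yields a single logarithm; the stated bound follows by
    weakening.\<close>
  have "(\<lambda>n. enn2real (max_th_pzf n)) \<in> O(\<lambda>n. sqrt (real n) * ln (real n))"
  proof (rule landau_o.bigI[of 86])
    show "\<forall>\<^sub>F n in sequentially. norm (enn2real (max_th_pzf n)) \<le> 86 * norm (sqrt (real n) * ln (real n))"
      using eventually_ge_at_top[of 3] by eventually_elim (use bounds in \<open>auto simp: abs_mult\<close>)
  qed simp
  also have "(\<lambda>n. sqrt (real n) * ln (real n)) \<in> O(\<lambda>n. sqrt (real n) * (ln (real n))\<^sup>2)"
    by real_asymp
  finally show "(\<lambda>n. enn2real (max_th_pzf n)) \<in> O(\<lambda>n. sqrt (real n) * (ln (real n))\<^sup>2)" .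
qed

end
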